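(* The network distance $d_{\mathcal N}$ is a metric on $\mathcal N$ modulo Type II weak isomorphism; that is, for all networks $X,Y,Z\in\mathcal N$: $d_{\mathcal N}(X,Y)\ge 0$; $d_{\mathcal N}(X,X)=0$; $d_{\mathcal N}(X,Y)=d_{\mathcal N}(Y,X)$; $d_{\mathcal N}(X,Z)\le d_{\mathcal N}(X,Y)+d_{\mathcal N}(Y,Z)$; and $d_{\mathcal N}(X,Y)=0$ if and only if $X$ and $Y$ are Type II weakly isomorphic.
   Context: A network is a pair $(X,\omega_X)$ where $X$ is a first countable topological space and $\omega_X:X\times X\to\mathbb R$ is continuous (product topology); $\mathcal N$ denotes the collection of all networks. A correspondence between sets $X$ and $Y$ is a relation $R\subseteq X\times Y$ whose projections onto $X$ and onto $Y$ are both surjective; $\mathcal R(X,Y)$ is the set of correspondences. The distortion of $R$ is $\mathrm{dis}(R)=\sup_{(x,y),(x',y')\in R}|\omega_X(x,x')-\omega_Y(y,y')|$, and $d_{\mathcal N}(X,Y)=\tfrac12\inf_{R\in\mathcal R(X,Y)}\mathrm{dis}(R)$. Networks $X,Y$ are Type II weakly isomorphic if for every $\varepsilon>0$ there exist a set $Z_\varepsilon$ and surjections $\phi_X:Z_\varepsilon\to X$, $\phi_Y:Z_\varepsilon\to Y$ with $|\omega_X(\phi_X(z),\phi_X(z'))-\omega_Y(\phi_Y(z),\phi_Y(z'))|<\varepsilon$ for all $z,z'\in Z_\varepsilon$. *)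

theory Defs
  imports "HOL-Analysis.Analysis"
begin

type_synonym 'a network = "'a topology \<times> ('a \<times> 'a \<Rightarrow> real)"

abbreviation points :: "'a network \<Rightarrow> 'a set"
  where "points X \<equiv> topspace (fst X)"

abbreviation weight :: "'a network \<Rightarrow> 'a \<Rightarrow> 'a \<Rightarrow> real"
  where "weight X x x' \<equiv> snd X (x, x')"

definition networks :: "'a network set"
  where "networks =
    {(T, \<omega>). first_countable T \<and> continuous_map (prod_topology T T) euclideanreal \<omega>}"

definition correspondences :: "'a set \<Rightarrow> 'b set \<Rightarrow> ('a \<times> 'b) set set"
  where "correspondences A B = {R. R \<subseteq> A \<times> B \<and> fst ` R = A \<and> snd ` R = B}"

text \<open>Weight functions may be unbounded, so distortion and distance take values in the extended
  reals. The supremum is one of nonnegative quantities, hence the value 0 on the empty relation,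
  which is the only correspondence between two empty networks (and is a correspondence in no other
  case).\<close>

definition distortion :: "'a network \<Rightarrow> 'b network \<Rightarrow> ('a \<times> 'b) set \<Rightarrow> ereal"
  where "distortion X Y R =
    (if R = {} then 0
     else SUP ((x, y), (x', y')) \<in> R \<times> R. ereal \<bar>weight X x x' - weight Y y y'\<bar>)"

text \<open>The infimum over the empty set is \<open>\<infinity>\<close>; this concerns only an empty network against a
  nonempty one.\<close>

definition network_dist :: "'a network \<Rightarrow> 'b network \<Rightarrow> ereal"
  where "network_dist X Y =
    ereal (1/2) * (INF R \<in> correspondences (points X) (points Y). distortion X Y R)"

definition tripod_within ::
    "real \<Rightarrow> 'a network \<Rightarrow> 'b network \<Rightarrow> 'z set \<Rightarrow> ('z \<Rightarrow> 'a) \<Rightarrow> ('z \<Rightarrow> 'b) \<Rightarrow> bool"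
  where "tripod_within \<epsilon> X Y Z \<phi> \<psi> \<longleftrightarrow>
    \<phi> ` Z = points X \<and> \<psi> ` Z = points Y \<and>
    (\<forall>z\<in>Z. \<forall>z'\<in>Z. \<bar>weight X (\<phi> z) (\<phi> z') - weight Y (\<psi> z) (\<psi> z')\<bar> < \<epsilon>)"

text \<open>HOL cannot quantify existentially over the type of the elements of \<open>Z\<close>, so \<open>Z\<close> ranges over
  the subsets of the product type. Lemma \<open>tripod_within_any_type\<close> shows that, for each \<open>\<epsilon>\<close>
  separately, sets \<open>Z\<close> over any other type give nothing more.\<close>

definition type_II_weakly_isomorphic :: "'a network \<Rightarrow> 'b network \<Rightarrow> bool"
  where "type_II_weakly_isomorphic X Y \<longleftrightarrow>
    (\<forall>\<epsilon>>0. \<exists>(Z :: ('a \<times> 'b) set) \<phi> \<psi>. tripod_within \<epsilon> X Y Z \<phi> \<psi>)"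

lemma tripod_within_any_type:
  fixes X :: "'a network" and Y :: "'b network" and Z :: "'z set"
  assumes "tripod_within \<epsilon> X Y Z \<phi> \<psi>"
  shows "\<exists>(Z' :: ('a \<times> 'b) set) \<phi>' \<psi>'. tripod_within \<epsilon> X Y Z' \<phi>' \<psi>'"
proof -
  have "tripod_within \<epsilon> X Y ((\<lambda>z. (\<phi> z, \<psi> z)) ` Z) fst snd"
    using assms by (simp add: tripod_within_def image_image)
  then show ?thesis by blast
qed

end

theory Submission
  imports Defs
begin

text \<open>
  Correspondences behave like approximate bijections: the converse of a correspondence has the same
  distortion, and relational composition is subadditive for distortion, so symmetry and the triangle
  inequality follow by passing to infima. A correspondence of distortion below \<open>\<epsilon>\<close> is itself
  the set of a tripod, with the two projections as surjections; conversely the joint image of a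
  tripod in the product is a correspondence.
\<close>

text \<open>The hypothesis \<open>0 \<le> c\<close> accounts for the empty relation, whose
  distortion is fixed as 0 instead of the \<open>ereal\<close> supremum of the empty set, which is
  -\<infinity>.\<close>

lemma distortion_le_iff:
  assumes "0 \<le> c"
  shows "distortion X Y R \<le> c \<longleftrightarrow>
    (\<forall>(x, y)\<in>R. \<forall>(x', y')\<in>R. ereal \<bar>weight X x x' - weight Y y y'\<bar> \<le> c)"
  using assms by (auto simp: distortion_def SUP_le_iff)

lemma weight_diff_le_distortion:
  assumes "(x, y) \<in> R" and "(x', y') \<in> R"
  shows "ereal \<bar>weight X x x' - weight Y y y'\<bar> \<le> distortion X Y R"
proof -
  have "R \<noteq> {}"
    using assms by blast
  then show ?thesis
    unfolding distortion_def using assms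
    by (auto intro!: SUP_upper2[of "((x, y), (x', y'))"])
qed

lemma distortion_nonneg: "0 \<le> distortion X Y R"
proof (cases "R = {}")
  case False
  then obtain x y where "(x, y) \<in> R"
    by auto
  then have "ereal \<bar>weight X x x - weight Y y y\<bar> \<le> distortion X Y R"
    by (intro weight_diff_le_distortion)
  then show ?thesis
    by (rule order_trans[rotated]) simp
qed (simp add: distortion_def)

lemma distortion_Id_on: "distortion X X (Id_on A) = 0"
proof (rule antisym)
  show "distortion X X (Id_on A) \<le> 0"
    by (subst distortion_le_iff) auto
qed (rule distortion_nonneg)

lemma distortion_converse_le: "distortion Y X (R\<inverse>) \<le> distortion X Y R"
proof -
  have "ereal \<bar>weight Y y y' - weight X x x'\<bar> \<le> distortion X Y R"
    if "(x, y) \<in> R" "(x', y') \<in> R" for x y x' y'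
    using weight_diff_le_distortion[OF that, of X Y] by (simp add: abs_minus_commute)
  then show ?thesis
    by (auto simp: distortion_le_iff distortion_nonneg)
qed

text \<open>Two pairs of \<open>R O S\<close> pass through intermediate points \<open>y\<close> and
  \<open>y'\<close>; the triangle inequality in the reals is applied through
  \<open>weight Y y y'\<close>.\<close>

lemma distortion_relcomp_le: "distortion X Z (R O S) \<le> distortion X Y R + distortion Y Z S"
proof -
  have "ereal \<bar>weight X x x' - weight Z z z'\<bar> \<le> distortion X Y R + distortion Y Z S"
    if "(x, y) \<in> R" "(y, z) \<in> S" "(x', y') \<in> R" "(y', z') \<in> S" for x y z x' y' z'
  proof -
    have "ereal \<bar>weight X x x' - weight Z z z'\<bar>
        \<le> ereal \<bar>weight X x x' - weight Y y y'\<bar> + ereal \<bar>weight Y y y' - weight Z z z'\<bar>"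
      by simp
    also have "\<dots> \<le> distortion X Y R + distortion Y Z S"
      using that by (intro add_mono weight_diff_le_distortion)
    finally show ?thesis .
  qed
  moreover have "0 \<le> distortion X Y R + distortion Y Z S"
    by (intro add_nonneg_nonneg distortion_nonneg)
  ultimately show ?thesis
    by (auto simp: distortion_le_iff)
qed

lemma Id_on_correspondence: "Id_on A \<in> correspondences A A"
  by (auto simp: correspondences_def image_iff Id_on_def)

lemma converse_correspondence:
  assumes "R \<in> correspondences A B"
  shows "R\<inverse> \<in> correspondences B A"
  using assms by (auto simp: correspondences_def fst_eq_Domain snd_eq_Range)

lemma relcomp_correspondence:
  assumes "R \<in> correspondences A B" and "S \<in> correspondences B C"
  shows "R O S \<in> correspondences A C"
proof -
  have "R \<subseteq> A \<times> B" "Domain R = A" "Range R = B" "S \<subseteq> B \<times> C" "Domain S = B" "Range S = C"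
    using assms by (auto simp: correspondences_def fst_eq_Domain snd_eq_Range)
  then have "R O S \<subseteq> A \<times> C" "Domain (R O S) = A" "Range (R O S) = C"
    by blast+
  then show ?thesis
    by (simp add: correspondences_def fst_eq_Domain snd_eq_Range)
qed

text \<open>A strict upper bound on an infimum is witnessed by a single member, so no minimizing
  correspondence is required; the 2 cancels the factor 1/2.\<close>

lemma network_dist_less_iff:
  "network_dist X Y < ereal r \<longleftrightarrow>
    (\<exists>R\<in>correspondences (points X) (points Y). distortion X Y R < ereal (2 * r))"
proof -
  have "ereal (1/2) * d < ereal r \<longleftrightarrow> d < ereal (2 * r)" for d :: ereal
    by (cases d) auto
  then show ?thesis
    by (simp only: network_dist_def INF_less_iff)
qed

lemma network_dist_nonneg: "0 \<le> network_dist X Y"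
  unfolding network_dist_def
  by (intro ereal_0_le_mult INF_greatest distortion_nonneg) simp

lemma network_dist_eq_0_iff: "network_dist X Y = 0 \<longleftrightarrow> (\<forall>\<epsilon>>0. network_dist X Y < ereal \<epsilon>)"
proof
  assume *: "\<forall>\<epsilon>>0. network_dist X Y < ereal \<epsilon>"
  have "network_dist X Y \<le> 0"
    by (rule ereal_le_epsilon2) (use * in \<open>auto intro: less_imp_le\<close>)
  then show "network_dist X Y = 0"
    using network_dist_nonneg by (rule antisym)
qed auto

lemma network_dist_self: "network_dist X X = 0"
  unfolding network_dist_eq_0_iff network_dist_less_iff
  using Id_on_correspondence by (force simp: distortion_Id_on)

text \<open>Each correspondence competing on the right yields its converse on the left. Exchanging
  \<open>X\<close> and \<open>Y\<close> gives the other half of symmetry.\<close>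

lemma network_dist_commute_le: "network_dist Y X \<le> network_dist X Y"
  unfolding network_dist_def
  by (intro ereal_mult_left_mono INF_mono)
    (auto intro: converse_correspondence distortion_converse_le)

lemma network_dist_triangle: "network_dist X Z \<le> network_dist X Y + network_dist Y Z"
\<comment> \<open>If either distance is infinite, so is the sum; otherwise nonnegativity makes both
  of them real.\<close>
proof (cases "network_dist X Y = \<infinity> \<or> network_dist Y Z = \<infinity>")
  case False
  then obtain a b where ab: "network_dist X Y = ereal a" "network_dist Y Z = ereal b"
    using network_dist_nonneg[of X Y] network_dist_nonneg[of Y Z]
    by (cases "network_dist X Y"; cases "network_dist Y Z") auto
  show ?thesis
  proof (rule ereal_le_epsilon2)
    fix e :: real
    assume "0 < e"
    \<comment> \<open>The infima need not be attained, so each distance gets a slack of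
      \<open>e/2\<close>.\<close>
    then have "network_dist X Y < ereal (a + e/2)" "network_dist Y Z < ereal (b + e/2)"
      by (simp_all add: ab)
    then obtain R S where
      R: "R \<in> correspondences (points X) (points Y)" "distortion X Y R < ereal (2 * (a + e/2))" and
      S: "S \<in> correspondences (points Y) (points Z)" "distortion Y Z S < ereal (2 * (b + e/2))"
      unfolding network_dist_less_iff by blast
    have "distortion X Z (R O S) \<le> distortion X Y R + distortion Y Z S"
      by (rule distortion_relcomp_le)
    also have "\<dots> < ereal (2 * (a + e/2)) + ereal (2 * (b + e/2))"
      using R S by (intro ereal_add_strict_mono2)
    also have "\<dots> = ereal (2 * (a + b + e))"
      by simp
    finally have "network_dist X Z < ereal (a + b + e)"
      unfolding network_dist_less_iff using relcomp_correspondence[OF R(1) S(1)] by blast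
    then show "network_dist X Z \<le> network_dist X Y + network_dist Y Z + ereal e"
      by (simp add: ab)
  qed
qed auto

lemma tripod_of_correspondence:
  assumes "R \<in> correspondences (points X) (points Y)" and "distortion X Y R < ereal \<epsilon>"
  shows "tripod_within \<epsilon> X Y R fst snd"
proof -
  have "\<bar>weight X x x' - weight Y y y'\<bar> < \<epsilon>" if "(x, y) \<in> R" "(x', y') \<in> R" for x y x' y'
    using le_less_trans[OF weight_diff_le_distortion[OF that] assms(2)] by simp
  then show ?thesis
    using assms(1) by (auto simp: tripod_within_def correspondences_def)
qed

text \<open>Passing to the supremum loses strictness, hence the bound \<le>. The hypothesis
  \<open>0 \<le> \<epsilon>\<close> matters for empty \<open>Z\<close>, where the tripod condition
  puts no constraint on \<epsilon>.\<close>

lemma correspondence_of_tripod: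
  assumes "tripod_within \<epsilon> X Y Z \<phi> \<psi>" and "0 \<le> \<epsilon>"
  defines "R \<equiv> (\<lambda>z. (\<phi> z, \<psi> z)) ` Z"
  shows "R \<in> correspondences (points X) (points Y)" and "distortion X Y R \<le> ereal \<epsilon>"
proof -
  have im: "\<phi> ` Z = points X" "\<psi> ` Z = points Y"
    and bd: "\<And>z z'. z \<in> Z \<Longrightarrow> z' \<in> Z \<Longrightarrow>
      \<bar>weight X (\<phi> z) (\<phi> z') - weight Y (\<psi> z) (\<psi> z')\<bar> < \<epsilon>"
    using assms(1) by (simp_all add: tripod_within_def)
  show "R \<in> correspondences (points X) (points Y)"
    unfolding correspondences_def R_def im[symmetric] by (auto simp: image_image)
  show "distortion X Y R \<le> ereal \<epsilon>"
    using bd \<open>0 \<le> \<epsilon>\<close> by (auto simp: distortion_le_iff R_def intro: less_imp_le)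
qed

lemma network_dist_eq_0_iff_weakly_isomorphic:
  "network_dist X Y = 0 \<longleftrightarrow> type_II_weakly_isomorphic X Y"
proof
  assume zero: "network_dist X Y = 0"
  show "type_II_weakly_isomorphic X Y"
    unfolding type_II_weakly_isomorphic_def
  proof (intro allI impI)
    fix \<epsilon> :: real
    assume "0 < \<epsilon>"
    \<comment> \<open>Half of \<epsilon>, because distortion is compared with twice the bound on the
      distance.\<close>
    then have "network_dist X Y < ereal (\<epsilon>/2)"
      by (simp add: zero)
    then obtain R where "R \<in> correspondences (points X) (points Y)" "distortion X Y R < ereal \<epsilon>"
      by (auto simp: network_dist_less_iff)
    then show "\<exists>Z \<phi> \<psi>. tripod_within \<epsilon> X Y (Z :: ('a \<times> 'b) set) \<phi> \<psi>"
      using tripod_of_correspondence by blast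
  qed
next
  assume iso: "type_II_weakly_isomorphic X Y"
  show "network_dist X Y = 0"
    unfolding network_dist_eq_0_iff network_dist_less_iff
  proof (intro allI impI)
    fix \<epsilon> :: real
    assume "0 < \<epsilon>"
    with iso obtain Z :: "('a \<times> 'b) set" and \<phi> \<psi> where "tripod_within \<epsilon> X Y Z \<phi> \<psi>"
      unfolding type_II_weakly_isomorphic_def by blast
    note R = correspondence_of_tripod[OF this less_imp_le[OF \<open>0 < \<epsilon>\<close>]]
    \<comment> \<open>The factor 2 restores the strictness lost in the supremum, so the same
      \<epsilon> serves for the tripod and for the distance.\<close>
    have "ereal \<epsilon> < ereal (2 * \<epsilon>)"
      using \<open>0 < \<epsilon>\<close> by simp
    with R show "\<exists>R\<in>correspondences (points X) (points Y). distortion X Y R < ereal (2 * \<epsilon>)"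
      using le_less_trans by blast
  qed
qed

theorem mainTheorem1:
  fixes X :: "'a network" and Y :: "'b network" and Z :: "'c network"
  assumes "X \<in> networks" and "Y \<in> networks" and "Z \<in> networks"
  shows "network_dist X Y \<ge> 0
    \<and> network_dist X X = 0
    \<and> network_dist X Y = network_dist Y X
    \<and> network_dist X Z \<le> network_dist X Y + network_dist Y Z
    \<and> (network_dist X Y = 0 \<longleftrightarrow> type_II_weakly_isomorphic X Y)"
  by (intro conjI network_dist_nonneg network_dist_self network_dist_triangle
      network_dist_eq_0_iff_weakly_isomorphic antisym network_dist_commute_le)

end
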